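(* Let $n\ge 2$, let $r,s\in\mathbb{C}$ be nonzero with $r\neq s$ and $s\neq -r$, and let $V$ be an $n$-dimensional complex vector space with basis $v_1,\dots,v_n$ and matrix units $E_{ij}$ ($E_{ij}v_k=\delta_{jk}v_i$). Let $R\in \mathrm{End}(V\otimes V)$ be $$R=\sum_{i=1}^nE_{ii}\otimes E_{ii}+r\sum_{i<j}E_{ji}\otimes E_{ij}+s^{-1}\sum_{i<j}E_{ij}\otimes E_{ji}+(1-rs^{-1})\sum_{i<j}E_{jj}\otimes E_{ii},$$ which has the two distinct eigenvalues $\lambda_1=-rs^{-1}$ and $\lambda_2=1$. Then the Yang-Baxterization $R(z)=\lambda_2^{-1}R+z\lambda_1R^{-1}$ of $R$ is given by $$R(z)=(1-zrs^{-1})\sum_{i=1}^nE_{ii}\otimes E_{ii}+(1-z)\Big(r\sum_{i>j}E_{ij}\otimes E_{ji}+s^{-1}\sum_{i<j}E_{ij}\otimes E_{ji}\Big)+z(1-rs^{-1})\sum_{i<j}E_{ii}\otimes E_{jj}+(1-rs^{-1})\sum_{i>j}E_{ii}\otimes E_{jj},$$ and it is an R-matrix with spectral parameter, i.e. for all $z,w\in\mathbb{C}$ one has on $V^{\otimes 3}$ $$R_1(z)R_2(zw)R_1(w)=R_2(w)R_1(zw)R_2(z).$$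
   Context: All sums run over indices $i,j\in\{1,\dots,n\}$ subject to the indicated inequality. Tensor products of operators act by $(A\otimes B)(v\otimes w)=Av\otimes Bw$. On $V^{\otimes 3}$, $R_1(z)=R(z)\otimes \mathrm{Id}_V$ and $R_2(z)=\mathrm{Id}_V\otimes R(z)$. The operator $R$ is the braiding $R_{VV}$ on $V\otimes V$, where $V$ is the natural representation of the two-parameter quantum group $U_{r,s}(\mathfrak{sl}_n)$. Yang-Baxterization: for a solution $R$ of the braid relation with two distinct eigenvalues $\lambda_1,\lambda_2$, its Yang-Baxterization is the spectral-parameter-dependent operator $R(z)=\lambda_2^{-1}R+z\lambda_1R^{-1}$, which is a spectral-parameter-dependent R-matrix, meaning that it satisfies $R_1(z)R_2(zw)R_1(w)=R_2(w)R_1(zw)R_2(z)$. *)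

theory Defs
  imports "HOL-Analysis.Analysis"
begin

text \<open>
  The space \<open>V\<close> with its basis \<open>v\<^sub>1, \<dots>, v\<^sub>n\<close> is \<open>complex ^ 'n\<close> with the standard basis
  \<open>axis i 1\<close>, where the index type \<open>'n :: {finite, linorder}\<close> plays the role of the ordered set
  \<open>{1, \<dots>, n}\<close>. Endomorphisms are square matrices acting by \<open>*v\<close> and composed by \<open>**\<close>. The spaces
  \<open>V \<otimes> V\<close> and \<open>V \<otimes> V \<otimes> V\<close> are \<open>complex ^ ('n \<times> 'n)\<close> and \<open>complex ^ ('n \<times> 'n \<times> 'n)\<close>, the
  component with index \<open>(i, j)\<close>, respectively \<open>(i, j, k)\<close>, being the coefficient of the
  corresponding tensor of basis vectors.
\<close>

definition tensor_vec :: "complex ^ 'a::finite \<Rightarrow> complex ^ 'b::finite \<Rightarrow> complex ^ ('a \<times> 'b)"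
    (infixr "\<otimes>\<^sub>v" 75)
  where "x \<otimes>\<^sub>v y = (\<chi> p. x $ fst p * y $ snd p)"

definition tensor_op ::
    "complex ^ 'b::finite ^ 'a::finite \<Rightarrow> complex ^ 'd::finite ^ 'c::finite \<Rightarrow>
      complex ^ ('b \<times> 'd) ^ ('a \<times> 'c)"
    (infixr "\<otimes>" 75)
  where "A \<otimes> B = (\<chi> p q. A $ fst p $ fst q * B $ snd p $ snd q)"

definition scale_op :: "complex \<Rightarrow> complex ^ 'b ^ 'a \<Rightarrow> complex ^ 'b ^ 'a"
    (infixr "\<cdot>\<^sub>m" 70)
  where "c \<cdot>\<^sub>m A = (\<chi> i. c *s A $ i)"

definition matrix_unit :: "'n::finite \<Rightarrow> 'n \<Rightarrow> complex ^ 'n ^ 'n"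
  where "matrix_unit i j = (\<chi> k l. if k = i \<and> l = j then 1 else 0)"

definition eigenvalue :: "complex ^ 'n ^ 'n \<Rightarrow> complex \<Rightarrow> bool"
  where "eigenvalue A c \<longleftrightarrow> (\<exists>x. x \<noteq> 0 \<and> A *v x = c *s x)"

text \<open>
  \<open>A \<otimes> mat 1\<close> has row and column indices of the form \<open>((i, j), k)\<close>; they are rebracketed so that
  both operators below act on the same space.
\<close>

definition op1 :: "complex ^ ('n::finite \<times> 'n) ^ ('n \<times> 'n) \<Rightarrow>
    complex ^ ('n \<times> 'n \<times> 'n) ^ ('n \<times> 'n \<times> 'n)"
  where "op1 A = (\<chi> p q. case (p, q) of ((i, j, k), (i', j', k')) \<Rightarrow>
    (A \<otimes> (mat 1 :: complex ^ 'n::finite ^ 'n)) $ ((i, j), k) $ ((i', j'), k'))"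

definition op2 :: "complex ^ ('n::finite \<times> 'n) ^ ('n \<times> 'n) \<Rightarrow>
    complex ^ ('n \<times> 'n \<times> 'n) ^ ('n \<times> 'n \<times> 'n)"
  where "op2 A = (mat 1 :: complex ^ 'n::finite ^ 'n) \<otimes> A"

definition yang_baxterization ::
    "complex ^ 'm ^ 'm \<Rightarrow> complex \<Rightarrow> complex \<Rightarrow> complex \<Rightarrow> complex ^ 'm ^ 'm"
  where "yang_baxterization R l1 l2 z = inverse l2 \<cdot>\<^sub>m R + (z * l1) \<cdot>\<^sub>m matrix_inv R"

text \<open>The conventions agree with the defining actions on basis vectors and pure tensors.\<close>

lemma matrix_unit_axis:
  "matrix_unit i j *v axis k 1 = (if j = k then axis i 1 else 0)"
  by (auto simp: matrix_unit_def matrix_vector_mult_def axis_def vec_eq_iff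
      if_distrib[of "\<lambda>x. _ * x"] cong: if_cong)

lemma tensor_op_tensor_vec: "(A \<otimes> B) *v (x \<otimes>\<^sub>v y) = (A *v x) \<otimes>\<^sub>v (B *v y)"
  by (simp add: tensor_op_def tensor_vec_def vec_eq_iff matrix_vector_mult_def sum_product
      sum.cartesian_product case_prod_beta ac_simps flip: UNIV_Times_UNIV)

lemma op1_tensor_op: "op1 (A \<otimes> B) = A \<otimes> B \<otimes> mat 1"
  by (simp add: op1_def tensor_op_def vec_eq_iff ac_simps)

end

theory Submission
  imports Defs
begin

text \<open>
  Put \<open>q = r s\<inverse>\<close>. On the span of \<open>v\<^sub>i \<otimes> v\<^sub>j\<close> and \<open>v\<^sub>j \<otimes> v\<^sub>i\<close> with \<open>i < j\<close> the operator
  \<open>R\<close> is a \<open>2 \<times> 2\<close> matrix with trace \<open>1 - q\<close> and determinant \<open>- q\<close>, and it fixes every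
  \<open>v\<^sub>i \<otimes> v\<^sub>i\<close>; so \<open>(R - 1) (R + q) = 0\<close> and \<open>R(z) = (1 - z) R + z (1 - q)\<close>. All operators
  involved are combinations of the diagonal and of the flip with coefficients depending on the
  pair of indices. On \<open>V \<otimes> V \<otimes> V\<close> the Yang--Baxter equation therefore becomes, for each relative
  order of three indices, a polynomial identity in \<open>r\<close>, \<open>s\<inverse>\<close>, \<open>z\<close>, \<open>w\<close>. The braid relation is
  the case \<open>z = w = 0\<close>, since \<open>R(0) = R\<close>.
\<close>

section \<open>Calculus of operators built from the flip and diagonals\<close>

text \<open>Coefficients are read at the row index: \<open>a\<close> weights the flip,
  \<open>b\<close> the diagonal. Sums, multiples and products stay in this class, so operator
  identities reduce to scalar ones.\<close>

definition flip_diag_op :: "('n \<Rightarrow> 'n \<Rightarrow> complex) \<Rightarrow> ('n \<Rightarrow> 'n \<Rightarrow> complex) \<Rightarrow>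
    complex ^ ('n::finite \<times> 'n) ^ ('n \<times> 'n)"
  where "flip_diag_op a b = (\<chi> p q. a (fst p) (snd p) * of_bool (q = prod.swap p) +
    b (fst p) (snd p) * of_bool (q = p))"

lemma flip_diag_op_nth:
  "flip_diag_op a b $ (i, j) $ q = a i j * of_bool (q = (j, i)) + b i j * of_bool (q = (i, j))"
  by (simp add: flip_diag_op_def)

lemma op1_flip_diag_op_nth:
  "op1 (flip_diag_op a b) $ (i, j, k) $ q =
    a i j * of_bool (q = (j, i, k)) + b i j * of_bool (q = (i, j, k))"
proof (cases q)
  case (fields i' j' k')
  then show ?thesis
    by (cases "k = k'") (simp_all add: op1_def tensor_op_def flip_diag_op_nth mat_def)
qed

lemma op2_flip_diag_op_nth:
  "op2 (flip_diag_op a b) $ (i, j, k) $ q =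
    a j k * of_bool (q = (i, k, j)) + b j k * of_bool (q = (i, j, k))"
proof (cases q)
  case (fields i' j' k')
  then show ?thesis
    by (cases "i = i'") (simp_all add: op2_def tensor_op_def flip_diag_op_nth mat_def)
qed

text \<open>Each row of these matrices is supported on at most two columns, so every matrix-vector
  product collapses to two terms.\<close>

lemma sum_two_points:
  fixes f :: "'a::finite \<Rightarrow> 'b::comm_semiring_1"
  shows "(\<Sum>q\<in>UNIV. (c * of_bool (q = u) + d * of_bool (q = v)) * f q) = c * f u + d * f v"
proof -
  have "(\<Sum>q\<in>UNIV. (c * of_bool (q = u) + d * of_bool (q = v)) * f q) =
      (\<Sum>q\<in>UNIV. if q = u then c * f q else 0) + (\<Sum>q\<in>UNIV. if q = v then d * f q else 0)"
    unfolding sum.distrib[symmetric] by (rule sum.cong) (simp_all add: distrib_right)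
  then show ?thesis
    by simp
qed

lemma flip_diag_op_vector:
  "(flip_diag_op a b *v x) $ (i, j) = a i j * x $ (j, i) + b i j * x $ (i, j)"
  by (simp add: matrix_vector_mult_def flip_diag_op_nth sum_two_points)

lemma op1_flip_diag_op_vector:
  "(op1 (flip_diag_op a b) *v x) $ (i, j, k) = a i j * x $ (j, i, k) + b i j * x $ (i, j, k)"
  by (simp add: matrix_vector_mult_def op1_flip_diag_op_nth sum_two_points)

lemma op2_flip_diag_op_vector:
  "(op2 (flip_diag_op a b) *v x) $ (i, j, k) = a j k * x $ (i, k, j) + b j k * x $ (i, j, k)"
  by (simp add: matrix_vector_mult_def op2_flip_diag_op_nth sum_two_points)

text \<open>The left flip exchanges the indices of the right coefficients, hence
  \<open>d j i\<close> and \<open>c j i\<close>; two flips cancel and contribute to the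
  diagonal.\<close>

lemma flip_diag_op_mult:
  "flip_diag_op a b ** flip_diag_op c d =
    flip_diag_op (\<lambda>i j. a i j * d j i + b i j * c i j) (\<lambda>i j. a i j * c j i + b i j * d i j)"
  by (simp add: matrix_eq vec_eq_iff flip_diag_op_vector algebra_simps
      flip: matrix_vector_mul_assoc)

lemma flip_diag_op_add:
  "flip_diag_op a b + flip_diag_op c d =
    flip_diag_op (\<lambda>i j. a i j + c i j) (\<lambda>i j. b i j + d i j)"
  by (simp add: flip_diag_op_def vec_eq_iff algebra_simps)

lemma scale_flip_diag_op:
  "c \<cdot>\<^sub>m flip_diag_op a b = flip_diag_op (\<lambda>i j. c * a i j) (\<lambda>i j. c * b i j)"
  by (simp add: flip_diag_op_def scale_op_def vec_eq_iff distrib_left mult.assoc)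

lemma mat_1_eq_flip_diag_op: "mat 1 = flip_diag_op (\<lambda>_ _. 0) (\<lambda>_ _. 1)"
  by (simp add: flip_diag_op_def mat_def vec_eq_iff of_bool_def eq_commute)

section \<open>Sums of matrix units as flip and diagonal operators\<close>

lemma tensor_matrix_unit_nth:
  "(matrix_unit a b \<otimes> matrix_unit c d) $ (i, j) $ (k, l) = of_bool ((a, c, b, d) = (i, j, k, l))"
  by (auto simp: tensor_op_def matrix_unit_def)

text \<open>The row index selects a single summand; \<open>Q\<close> carries the remaining condition
  on the column.\<close>

lemma sum_of_bool_pair:
  fixes P :: "'a::finite \<Rightarrow> 'a \<Rightarrow> bool"
  shows "(\<Sum>(i, j)\<in>{(i, j). P i j}. of_bool (i = k \<and> j = l \<and> Q)) =
    (of_bool (P k l \<and> Q) :: complex)"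
proof -
  have "(\<Sum>(i, j)\<in>{(i, j). P i j}. of_bool (i = k \<and> j = l \<and> Q)) =
      (\<Sum>p\<in>{(i, j). P i j}. if p = (k, l) then of_bool Q else 0 :: complex)"
    by (rule sum.cong) auto
  then show ?thesis
    by (simp add: of_bool_conj)
qed

text \<open>The only nonzero entry of \<open>matrix_unit i j \<otimes> matrix_unit j i\<close> is in
  row \<open>(i, j)\<close> and column \<open>(j, i)\<close>.\<close>

lemma sum_flip_matrix_units:
  "(\<Sum>(i, j)\<in>{(i, j). P i j}. matrix_unit i j \<otimes> matrix_unit j i) =
    flip_diag_op (\<lambda>i j. of_bool (P i j)) (\<lambda>_ _. 0)" (is "?L = ?R")
proof -
  have "?L $ (i, j) $ (k, l) = ?R $ (i, j) $ (k, l)" for i j k l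
  proof -
    have "?L $ (i, j) $ (k, l) =
        (\<Sum>(a, b)\<in>{(a, b). P a b}. of_bool (a = i \<and> b = j \<and> k = j \<and> l = i))"
      unfolding sum_component by (rule sum.cong) (auto simp: tensor_matrix_unit_nth)
    then show ?thesis
      unfolding sum_of_bool_pair by (simp only: flip_diag_op_nth) simp
  qed
  then show ?thesis
    by (simp add: vec_eq_iff)
qed

lemma sum_diag_matrix_units:
  "(\<Sum>(i, j)\<in>{(i, j). P i j}. matrix_unit i i \<otimes> matrix_unit j j) =
    flip_diag_op (\<lambda>_ _. 0) (\<lambda>i j. of_bool (P i j))" (is "?L = ?R")
proof -
  have "?L $ (i, j) $ (k, l) = ?R $ (i, j) $ (k, l)" for i j k l
  proof -
    have "?L $ (i, j) $ (k, l) =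
        (\<Sum>(a, b)\<in>{(a, b). P a b}. of_bool (a = i \<and> b = j \<and> k = i \<and> l = j))"
      unfolding sum_component by (rule sum.cong) (auto simp: tensor_matrix_unit_nth)
    then show ?thesis
      unfolding sum_of_bool_pair by (simp only: flip_diag_op_nth) simp
  qed
  then show ?thesis
    by (simp add: vec_eq_iff)
qed

text \<open>Turns the sums in R whose row index is \<open>(j, i)\<close> with \<open>i < j\<close>
  into sums over \<open>j < i\<close> indexed by the row.\<close>

lemma sum_pairs_swap:
  fixes f :: "'a::finite \<Rightarrow> 'a \<Rightarrow> 'b::comm_monoid_add"
  shows "(\<Sum>(i, j)\<in>{(i, j). P i j}. f j i) = (\<Sum>(i, j)\<in>{(i, j). P j i}. f i j)"
  by (rule sum.reindex_bij_witness[of _ prod.swap prod.swap]) auto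

lemma sum_diag_matrix_units_same:
  "(\<Sum>i\<in>UNIV. matrix_unit i i \<otimes> matrix_unit i i) =
    flip_diag_op (\<lambda>_ _. 0) (\<lambda>i j. of_bool (i = j))"
proof -
  have "(\<Sum>i\<in>UNIV. matrix_unit i i \<otimes> matrix_unit i i) =
      (\<Sum>(i, j)\<in>{(i, j). i = j}. matrix_unit i i \<otimes> matrix_unit j j)"
    by (rule sum.reindex_bij_witness[of _ fst "\<lambda>i. (i, i)"]) auto
  then show ?thesis
    by (simp only: sum_diag_matrix_units)
qed

section \<open>The Yang-Baxter equation on the triple tensor product\<close>

text \<open>Below, \<open>t\<close> stands for \<open>s\<inverse>\<close>, which keeps the identities polynomial.\<close>

definition yb_flip :: "complex \<Rightarrow> complex \<Rightarrow> complex \<Rightarrow> 'n::linorder \<Rightarrow> 'n \<Rightarrow> complex"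
  where "yb_flip r t z i j =
    (if i < j then (1 - z) * t else if j < i then (1 - z) * r else 0)"

text \<open>For \<open>i = j\<close> the flip and the diagonal hit the same entry. The whole entry
  is assigned to \<open>yb_diag\<close>, and \<open>yb_flip\<close> vanishes there, so that
  coefficients can be compared separately.\<close>

definition yb_diag :: "complex \<Rightarrow> complex \<Rightarrow> complex \<Rightarrow> 'n::linorder \<Rightarrow> 'n \<Rightarrow> complex"
  where "yb_diag r t z i j =
    (if i < j then z * (1 - r * t) else if j < i then 1 - r * t else 1 - z * r * t)"

definition yb_op :: "complex \<Rightarrow> complex \<Rightarrow> complex \<Rightarrow>
    complex ^ ('n::{finite,linorder} \<times> 'n) ^ ('n \<times> 'n)"
  where "yb_op r t z = flip_diag_op (yb_flip r t z) (yb_diag r t z)"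

text \<open>These are the thirteen weak orders of three elements. The strict cases list all three
  comparisons, so coefficients evaluate without appeal to transitivity.\<close>

lemma linorder_cases3:
  fixes i j k :: "'a::linorder"
  obtains "i = j" "j = k" | "i = j" "j < k" | "i = j" "k < j" | "i < j" "j = k"
    | "j < i" "j = k" | "i = k" "i < j" | "i = k" "j < i"
    | "i < j" "j < k" "i < k" | "i < k" "k < j" "i < j" | "j < i" "i < k" "j < k"
    | "j < k" "k < i" "j < i" | "k < i" "i < j" "k < j" | "k < j" "j < i" "k < i"
  by (cases i j rule: linorder_cases; cases j k rule: linorder_cases;
      cases i k rule: linorder_cases) (auto dest: less_trans)

text \<open>Choosing flip or diagonal in each factor gives eight words in the two adjacent swaps;
  the identity and \<open>(j, i, k)\<close> each arise twice, the other four permutations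
  once.\<close>

lemma op121_vector:
  "((op1 (flip_diag_op a b) ** op2 (flip_diag_op c d) ** op1 (flip_diag_op e f)) *v x) $ (i, j, k) =
    (a i j * d i k * e j i + b i j * d j k * f i j) * x $ (i, j, k)
    + (a i j * d i k * f j i + b i j * d j k * e i j) * x $ (j, i, k)
    + b i j * c j k * f i k * x $ (i, k, j) + b i j * c j k * e i k * x $ (k, i, j)
    + a i j * c i k * f j k * x $ (j, k, i) + a i j * c i k * e j k * x $ (k, j, i)"
  by (simp add: op1_flip_diag_op_vector op2_flip_diag_op_vector algebra_simps
      flip: matrix_vector_mul_assoc)

lemma op212_vector:
  "((op2 (flip_diag_op a b) ** op1 (flip_diag_op c d) ** op2 (flip_diag_op e f)) *v x) $ (i, j, k) =
    (a j k * d i k * e k j + b j k * d i j * f j k) * x $ (i, j, k)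
    + b j k * c i j * f i k * x $ (j, i, k)
    + (a j k * d i k * f k j + b j k * d i j * e j k) * x $ (i, k, j)
    + a j k * c i k * f i j * x $ (k, i, j) + b j k * c i j * e i k * x $ (j, k, i)
    + a j k * c i k * e i j * x $ (k, j, i)"
  by (simp add: op1_flip_diag_op_vector op2_flip_diag_op_vector algebra_simps
      flip: matrix_vector_mul_assoc)

text \<open>One identity for each permutation of \<open>(i, j, k)\<close> except
  \<open>(k, j, i)\<close>. The last two hold because \<open>yb_flip\<close> is \<open>1 - z\<close>
  times a function of the pair alone; the first three are checked order by order.\<close>

lemma yang_baxter_coeffs:
  fixes r t :: complex and i j k :: "'n::linorder"
  defines "a \<equiv> \<lambda>z. yb_flip r t z :: 'n \<Rightarrow> 'n \<Rightarrow> complex"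
    and "b \<equiv> \<lambda>z. yb_diag r t z :: 'n \<Rightarrow> 'n \<Rightarrow> complex"
  shows "a z i j * b (z * w) i k * a w j i + b z i j * b (z * w) j k * b w i j =
      a w j k * b (z * w) i k * a z k j + b w j k * b (z * w) i j * b z j k"
    and "a z i j * b (z * w) i k * b w j i + b z i j * b (z * w) j k * a w i j =
      b w j k * a (z * w) i j * b z i k"
    and "b z i j * a (z * w) j k * b w i k =
      a w j k * b (z * w) i k * b z k j + b w j k * b (z * w) i j * a z j k"
    and "b z i j * a (z * w) j k * a w i k = a w j k * a (z * w) i k * b z i j"
    and "a z i j * a (z * w) i k * b w j k = b w j k * a (z * w) i j * a z i k"
  unfolding a_def b_def
  by - (cases i j k rule: linorder_cases3;
    auto simp: yb_flip_def yb_diag_def algebra_simps dest: less_asym)+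

lemma yang_baxter_yb_op:
  "op1 (yb_op r t z) ** op2 (yb_op r t (z * w)) ** op1 (yb_op r t w) =
    op2 (yb_op r t w) ** op1 (yb_op r t (z * w)) ** op2 (yb_op r t z)" (is "?L = ?R")
proof -
  have "(?L *v x) $ (i, j, k) = (?R *v x) $ (i, j, k)" for x i j k
    \<comment> \<open>The remaining coefficient, at \<open>(k, j, i)\<close>, has the same three
      factors on both sides.\<close>
    unfolding yb_op_def op121_vector op212_vector yang_baxter_coeffs by (simp add: ac_simps)
  then show ?thesis
    by (simp add: matrix_eq vec_eq_iff)
qed

section \<open>Matching the formulas for R and R(z)\<close>

lemma R_matrix_eq_yb_op:
  "(\<Sum>i\<in>UNIV. matrix_unit i i \<otimes> matrix_unit i i)
    + r \<cdot>\<^sub>m (\<Sum>(i, j)\<in>{(i, j). i < j}. matrix_unit j i \<otimes> matrix_unit i j)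
    + t \<cdot>\<^sub>m (\<Sum>(i, j)\<in>{(i, j). i < j}. matrix_unit i j \<otimes> matrix_unit j i)
    + (1 - r * t) \<cdot>\<^sub>m (\<Sum>(i, j)\<in>{(i, j). i < j}. matrix_unit j j \<otimes> matrix_unit i i)
    = yb_op r t 0"
  unfolding sum_pairs_swap[where f = "\<lambda>i j. matrix_unit i j \<otimes> matrix_unit j i"]
    sum_pairs_swap[where f = "\<lambda>i j. matrix_unit i i \<otimes> matrix_unit j j"]
    sum_flip_matrix_units sum_diag_matrix_units sum_diag_matrix_units_same
    scale_flip_diag_op flip_diag_op_add yb_op_def
  by (rule arg_cong2[where f = flip_diag_op]; intro ext) (auto simp: yb_flip_def yb_diag_def)

lemma spectral_R_matrix_eq_yb_op:
  "(1 - z * r * t) \<cdot>\<^sub>m (\<Sum>i\<in>UNIV. matrix_unit i i \<otimes> matrix_unit i i)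
    + (1 - z) \<cdot>\<^sub>m (r \<cdot>\<^sub>m (\<Sum>(i, j)\<in>{(i, j). i > j}. matrix_unit i j \<otimes> matrix_unit j i)
      + t \<cdot>\<^sub>m (\<Sum>(i, j)\<in>{(i, j). i < j}. matrix_unit i j \<otimes> matrix_unit j i))
    + (z * (1 - r * t)) \<cdot>\<^sub>m (\<Sum>(i, j)\<in>{(i, j). i < j}. matrix_unit i i \<otimes> matrix_unit j j)
    + (1 - r * t) \<cdot>\<^sub>m (\<Sum>(i, j)\<in>{(i, j). i > j}. matrix_unit i i \<otimes> matrix_unit j j)
    = yb_op r t z"
  unfolding sum_flip_matrix_units sum_diag_matrix_units sum_diag_matrix_units_same
    scale_flip_diag_op flip_diag_op_add yb_op_def
  by (rule arg_cong2[where f = flip_diag_op]; intro ext) (auto simp: yb_flip_def yb_diag_def)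

section \<open>The inverse and the Yang-Baxterization\<close>

text \<open>The inverse comes from the Hecke relation \<open>R\<^sup>2 = (1 - q) R + q\<close> with \<open>q = r t\<close>.\<close>

definition yb_inv :: "complex \<Rightarrow> complex \<Rightarrow> complex ^ ('n::{finite,linorder} \<times> 'n) ^ ('n \<times> 'n)"
  where "yb_inv r t = inverse (r * t) \<cdot>\<^sub>m (yb_op r t 0 + (r * t - 1) \<cdot>\<^sub>m mat 1)"

lemma yb_inv:
  assumes "r \<noteq> 0" and "t \<noteq> 0"
  shows "yb_op r t 0 ** yb_inv r t = mat 1" and "yb_inv r t ** yb_op r t 0 = mat 1"
  unfolding yb_inv_def yb_op_def mat_1_eq_flip_diag_op scale_flip_diag_op flip_diag_op_add
    flip_diag_op_mult
  by (rule arg_cong2[where f = flip_diag_op]; intro ext;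
      use assms in \<open>auto simp: yb_flip_def yb_diag_def field_simps\<close>)+

text \<open>\<open>matrix_inv\<close> is a choice among two-sided inverses, and these are
  unique.\<close>

lemma matrix_inv_yb_op:
  assumes "r \<noteq> 0" and "t \<noteq> 0"
  shows "matrix_inv (yb_op r t 0 :: complex ^ ('n::{finite,linorder} \<times> 'n) ^ ('n \<times> 'n)) = yb_inv r t"
  unfolding matrix_inv_def
proof (rule some_equality)
  fix A :: "complex ^ ('n \<times> 'n) ^ ('n \<times> 'n)"
  assume "yb_op r t 0 ** A = mat 1 \<and> A ** yb_op r t 0 = mat 1"
  then show "A = yb_inv r t"
    by (metis yb_inv(1)[OF assms] matrix_mul_assoc matrix_mul_lid matrix_mul_rid)
qed (simp add: yb_inv[OF assms])

text \<open>With \<open>q = r * t\<close>, the factor \<open>- q\<close> cancels the denominator of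
  \<open>yb_inv\<close>, leaving R - z (R + q - 1).\<close>

lemma yang_baxterization_yb_op:
  assumes "r \<noteq> 0" and "t \<noteq> 0"
  shows "yang_baxterization (yb_op r t 0) (- (r * t)) 1 z = yb_op r t z"
  unfolding yang_baxterization_def matrix_inv_yb_op[OF assms]
  unfolding yb_inv_def yb_op_def mat_1_eq_flip_diag_op scale_flip_diag_op flip_diag_op_add
  by (rule arg_cong2[where f = flip_diag_op]; intro ext;
      use assms in \<open>auto simp: yb_flip_def yb_diag_def field_simps\<close>)

section \<open>Eigenvalues\<close>

lemma eigenvalue_yb_op:
  fixes r t :: complex
  assumes "CARD('n::{finite,linorder}) \<ge> 2"
  shows "{c. eigenvalue (yb_op r t 0 :: complex ^ ('n \<times> 'n) ^ ('n \<times> 'n)) c} = {- (r * t), 1}"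
proof -
  let ?R = "yb_op r t 0 :: complex ^ ('n \<times> 'n) ^ ('n \<times> 'n)"
  have R: "(?R *v x) $ (i, j) = yb_flip r t 0 i j * x $ (j, i) + yb_diag r t 0 i j * x $ (i, j)"
    for x i j
    by (simp add: yb_op_def flip_diag_op_vector)
  have "c = - (r * t) \<or> c = 1" if "eigenvalue ?R c" for c
  proof -
    from that obtain x where "x \<noteq> 0" and x: "?R *v x = c *s x"
      by (auto simp: eigenvalue_def)
    from \<open>x \<noteq> 0\<close> obtain i j where "x $ (i, j) \<noteq> 0"
      by (auto simp: vec_eq_iff)
    have eqs: "c * x $ (i, j) = yb_flip r t 0 i j * x $ (j, i) + yb_diag r t 0 i j * x $ (i, j)"
      "c * x $ (j, i) = yb_flip r t 0 j i * x $ (i, j) + yb_diag r t 0 j i * x $ (j, i)"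
      using R[of x] by (simp_all add: x)
    \<comment> \<open>The coordinates at \<open>(i, j)\<close> and \<open>(j, i)\<close> form a
      closed system; for \<open>i \<noteq> j\<close> this quadratic is its characteristic
      polynomial.\<close>
    have "(c + r * t) * (c - 1) * x $ (i, j) = 0"
    proof (cases i j rule: linorder_cases)
      case less
      with eqs have "c * x $ (i, j) = t * x $ (j, i)"
        and "c * x $ (j, i) = r * x $ (i, j) + (1 - r * t) * x $ (j, i)"
        by (auto simp: yb_flip_def yb_diag_def)
      then show ?thesis
        by algebra
    next
      case equal
      with eqs have "c * x $ (i, j) = x $ (i, j)"
        by (auto simp: yb_flip_def yb_diag_def)
      then show ?thesis
        by auto
    next
      case greater
      with eqs have "c * x $ (i, j) = r * x $ (j, i) + (1 - r * t) * x $ (i, j)"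
        and "c * x $ (j, i) = t * x $ (i, j)"
        by (auto simp: yb_flip_def yb_diag_def)
      then show ?thesis
        by algebra
    qed
    with \<open>x $ (i, j) \<noteq> 0\<close> show ?thesis
      by (auto simp: eq_neg_iff_add_eq_0)
  qed
  moreover have "eigenvalue ?R (- (r * t))"
  proof -
    \<comment> \<open>Two distinct indices exist; \<open>undefined\<close> is merely a reference
      element.\<close>
    from assms have "\<not> (UNIV :: 'n set) \<subseteq> {undefined}"
      using card_mono[of "{undefined :: 'n}" UNIV] by auto
    then obtain k :: 'n where "k \<noteq> undefined"
      by auto
    then obtain i j :: 'n where "i < j"
      by (metis linorder_neqE)
    \<comment> \<open>For the block of \<open>v_i \<otimes> v_j\<close> and
      \<open>v_j \<otimes> v_i\<close>, the vector \<open>(1, - r)\<close> is an eigenvector for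
      \<open>- (r * t)\<close>.\<close>
    define x :: "complex ^ ('n \<times> 'n)"
      where "x = (\<chi> p. if p = (i, j) then 1 else if p = (j, i) then - r else 0)"
    have "x $ (i, j) \<noteq> 0"
      by (simp add: x_def)
    then have "x \<noteq> 0"
      by auto
    moreover have "(?R *v x) $ (k, l) = (- (r * t) *s x) $ (k, l)" for k l
    proof -
      have ij: "x $ (i, j) = 1" "x $ (j, i) = - r"
        using less_imp_neq[OF \<open>i < j\<close>] by (simp_all add: x_def)
      consider "k = i" "l = j" | "k = j" "l = i" | "(k, l) \<notin> {(i, j), (j, i)}"
        by blast
      then show ?thesis
      proof cases
        case 3
        then have "x $ (k, l) = 0" and "x $ (l, k) = 0"
          by (auto simp: x_def)
        then show ?thesis
          by (simp add: R)
      qed (use \<open>i < j\<close> in \<open>auto simp: R ij yb_flip_def yb_diag_def algebra_simps\<close>)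
    qed
    then have "?R *v x = - (r * t) *s x"
      by (simp add: vec_eq_iff)
    ultimately show ?thesis
      unfolding eigenvalue_def by blast
  qed
  moreover have "eigenvalue ?R 1"
  proof -
    fix i :: 'n
    define x :: "complex ^ ('n \<times> 'n)" where "x = axis (i, i) 1"
    have "x \<noteq> 0"
      by (simp add: x_def axis_eq_0_iff)
    moreover have "(?R *v x) $ (k, l) = x $ (k, l)" for k l
      by (auto simp: R x_def axis_def yb_flip_def yb_diag_def)
    then have "?R *v x = 1 *s x"
      by (simp add: vec_eq_iff)
    ultimately show ?thesis
      unfolding eigenvalue_def by blast
  qed
  ultimately show ?thesis
    by auto
qed

theorem theorem3p1:
  fixes r s l1 l2 :: complex
    and E :: "'n \<Rightarrow> 'n \<Rightarrow> complex ^ 'n::{finite,linorder} ^ 'n::{finite,linorder}"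
    and R :: "complex ^ ('n \<times> 'n) ^ ('n \<times> 'n)"
    and Rz :: "complex \<Rightarrow> complex ^ ('n \<times> 'n) ^ ('n \<times> 'n)"
  assumes "CARD('n) \<ge> 2"
    and "r \<noteq> 0" and "s \<noteq> 0" and "r \<noteq> s" and "s \<noteq> - r"
    and "E = matrix_unit"
    and "R = (\<Sum>i\<in>UNIV. E i i \<otimes> E i i)
           + r \<cdot>\<^sub>m (\<Sum>(i, j)\<in>{(i, j). i < j}. E j i \<otimes> E i j)
           + inverse s \<cdot>\<^sub>m (\<Sum>(i, j)\<in>{(i, j). i < j}. E i j \<otimes> E j i)
           + (1 - r * inverse s) \<cdot>\<^sub>m (\<Sum>(i, j)\<in>{(i, j). i < j}. E j j \<otimes> E i i)"
    and "l1 = - (r * inverse s)" and "l2 = 1"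
    and "Rz = yang_baxterization R l1 l2"
  shows "op1 R ** op2 R ** op1 R = op2 R ** op1 R ** op2 R
    \<and> invertible R
    \<and> l1 \<noteq> l2
    \<and> {c. eigenvalue R c} = {l1, l2}
    \<and> (\<forall>z. Rz z =
             (1 - z * r * inverse s) \<cdot>\<^sub>m (\<Sum>i\<in>UNIV. E i i \<otimes> E i i)
           + (1 - z) \<cdot>\<^sub>m (r \<cdot>\<^sub>m (\<Sum>(i, j)\<in>{(i, j). i > j}. E i j \<otimes> E j i)
                       + inverse s \<cdot>\<^sub>m (\<Sum>(i, j)\<in>{(i, j). i < j}. E i j \<otimes> E j i))
           + (z * (1 - r * inverse s)) \<cdot>\<^sub>m (\<Sum>(i, j)\<in>{(i, j). i < j}. E i i \<otimes> E j j)
           + (1 - r * inverse s) \<cdot>\<^sub>m (\<Sum>(i, j)\<in>{(i, j). i > j}. E i i \<otimes> E j j))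
    \<and> (\<forall>z w. op1 (Rz z) ** op2 (Rz (z * w)) ** op1 (Rz w)
              = op2 (Rz w) ** op1 (Rz (z * w)) ** op2 (Rz z))"
proof -
  define t where "t = inverse s"
  have "t \<noteq> 0"
    using \<open>s \<noteq> 0\<close> by (simp add: t_def)
  have R: "R = yb_op r t 0"
    unfolding assms(6,7) t_def[symmetric] by (rule R_matrix_eq_yb_op)
  have l1: "l1 = - (r * t)"
    by (simp add: assms(8) t_def)
  have Rz: "Rz z = yb_op r t z" for z
    using yang_baxterization_yb_op[OF \<open>r \<noteq> 0\<close> \<open>t \<noteq> 0\<close>] by (simp add: assms(9,10) R l1)
  \<comment> \<open>Equality would give \<open>r * inverse s = - 1\<close>, that is
    \<open>s = - r\<close>.\<close>
  have "l1 \<noteq> l2"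
    using \<open>s \<noteq> 0\<close> \<open>s \<noteq> - r\<close> by (auto simp: assms(8,9) field_simps eq_neg_iff_add_eq_0)
  moreover have "invertible R"
    unfolding invertible_def R using yb_inv[OF \<open>r \<noteq> 0\<close> \<open>t \<noteq> 0\<close>] by blast
  moreover have "{c. eigenvalue R c} = {l1, l2}"
    unfolding R l1 \<open>l2 = 1\<close> by (rule eigenvalue_yb_op[OF assms(1)])
  moreover have "op1 R ** op2 R ** op1 R = op2 R ** op1 R ** op2 R"
    using yang_baxter_yb_op[of r t 0 0] by (simp add: R)
  ultimately show ?thesis
    unfolding Rz \<open>E = matrix_unit\<close> t_def[symmetric] spectral_R_matrix_eq_yb_op
    using yang_baxter_yb_op by blast
qed

end
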